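(* Let $C_j$, $j=1,\dots,n$, be $n$ independent first class constraints on $\mathcal{M}$ and let $x\in\mathcal{M}$ be a point on the constraint hypersurface $\mathcal{C}$. Let $T_1,\dots,T_n,f\in C^\infty(\mathcal{M})$ and $\tau=(\tau_1,\dots,\tau_n)\in\mathbb{R}^n$ be such that the intersection of the level set $\{z\in\mathcal{M}: T_i(z)=\tau_i,\ i=1,\dots,n\}$ with the gauge orbit $\mathcal{G}_x$ through $x$ is non-empty, and assume that $f$ takes the same value at all points of this intersection. Then the complete observable $F_{[f,T_1,\dots,T_n]}(\tau,x)$ is well defined and is invariant under the flow generated by the constraints: for all $\varepsilon\in\mathbb{R}^n$, $$F_{[f,T_1,\dots,T_n]}(\tau,\alpha_{\varepsilon_jC_j}(x))=F_{[f,T_1,\dots,T_n]}(\tau,x).$$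
   Context: $\mathcal{M}$ is a $2p$-dimensional smooth manifold with a non-degenerate Poisson bracket $\{\cdot,\cdot\}$. The constraints $C_1,\dots,C_n\in C^\infty(\mathcal{M})$, $n<p$, are independent, meaning that the constraint hypersurface $\mathcal{C}=\{C_1=\dots=C_n=0\}$ is a $(2p-n)$-dimensional submanifold, and first class: $\{C_i,C_j\}=\sum_k f_{ijk}C_k$ with $f_{ijk}\in C^\infty(\mathcal{M})$. For a phase space function $H$ the Hamiltonian vector field is $\chi_H(f)=\{H,f\}$, with flow $\alpha_H^t$. For $\beta\in\mathbb{R}^n$ put $\alpha_{\beta_jC_j}:=\alpha_{H}^{t=1}$ with $H=\sum_j\beta_jC_j$; these flows are assumed to be defined. The gauge orbit $\mathcal{G}_x$ of $x\in\mathcal{C}$ is the set of points reached from $x$ by finite compositions of flows generated by the constraints. Standing assumption: for every $x\in\mathcal{C}$, every point of $\mathcal{G}_x$ is of the form $\alpha_{\beta_jC_j}(x)$ for some $\beta\in\mathbb{R}^n$. The complete observable is $$F_{[f,T_1,\dots,T_n]}(\tau,x):=f(\alpha_{\beta_jC_j}(x))\big|_{T_i(\alpha_{\beta_jC_j}(x))=\tau_i,\ i=1,\dots,n},$$ i.e. the value $f(\alpha_{\beta_jC_j}(x))$ for any $\beta\in\mathbb{R}^n$ solving $T_i(\alpha_{\beta_jC_j}(x))=\tau_i$ for all $i$. It is well defined if such $\beta$ exists and the value is independent of the choice of such $\beta$. *)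

theory Defs
  imports "HOL-Analysis.Analysis"
begin

section \<open>Smooth manifolds\<close>

text \<open>
  The manifold is the whole type \<open>'m\<close> (a Hausdorff, second countable space), with smooth
  structure given by an atlas of charts \<open>(U, \<phi>)\<close> into a Euclidean space \<open>'e\<close>; its dimension is
  \<open>DIM('e)\<close>. The values of \<open>\<phi>\<close> outside \<open>U\<close> are irrelevant.
\<close>

primrec Ck_on :: "nat \<Rightarrow> 'a::real_normed_vector set \<Rightarrow> ('a \<Rightarrow> 'b::real_normed_vector) \<Rightarrow> bool"
  where
    "Ck_on 0 S f \<longleftrightarrow> continuous_on S f"
  | "Ck_on (Suc k) S f \<longleftrightarrow>
       (\<forall>x\<in>S. f differentiable (at x)) \<and>
       (\<forall>v. Ck_on k S (\<lambda>x. frechet_derivative f (at x) v))"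

text \<open>Only meaningful for open \<open>S\<close>, the only case used below.\<close>

definition smooth_on :: "'a::real_normed_vector set \<Rightarrow> ('a \<Rightarrow> 'b::real_normed_vector) \<Rightarrow> bool"
  where "smooth_on S f \<longleftrightarrow> (\<forall>k. Ck_on k S f)"

type_synonym ('m, 'e) chart = "'m set \<times> ('m \<Rightarrow> 'e)"

definition is_chart :: "('m::topological_space, 'e::euclidean_space) chart \<Rightarrow> bool"
  where "is_chart = (\<lambda>(U, \<phi>).
     open U \<and> open (\<phi> ` U) \<and> homeomorphism U (\<phi> ` U) \<phi> (inv_into U \<phi>))"

definition smooth_compatible ::
    "('m::topological_space, 'e::euclidean_space) chart \<Rightarrow> ('m, 'e) chart \<Rightarrow> bool"
  where "smooth_compatible = (\<lambda>(U, \<phi>) (V, \<psi>).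
     smooth_on (\<phi> ` (U \<inter> V)) (\<psi> \<circ> inv_into U \<phi>) \<and>
     smooth_on (\<psi> ` (U \<inter> V)) (\<phi> \<circ> inv_into V \<psi>))"

definition smooth_atlas ::
    "('m::{t2_space, second_countable_topology}, 'e::euclidean_space) chart set \<Rightarrow> bool"
  where "smooth_atlas A \<longleftrightarrow>
     (\<forall>c\<in>A. is_chart c) \<and> (\<Union>(U, \<phi>)\<in>A. U) = UNIV \<and>
     (\<forall>c\<in>A. \<forall>d\<in>A. smooth_compatible c d)"

definition maximal_atlas ::
    "('m::topological_space, 'e::euclidean_space) chart set \<Rightarrow> ('m, 'e) chart set"
  where "maximal_atlas A = {c. is_chart c \<and> (\<forall>d\<in>A. smooth_compatible c d)}"

definition smooth_functions ::
    "('m::topological_space, 'e::euclidean_space) chart set \<Rightarrow> ('m \<Rightarrow> real) set"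
  where "smooth_functions A =
     {f. \<forall>(U, \<phi>)\<in>A. smooth_on (\<phi> ` U) (f \<circ> inv_into U \<phi>)}"

text \<open>Embedded \<open>k\<close>-dimensional submanifolds, by slice charts.\<close>

definition is_submanifold ::
    "('m::topological_space, 'e::euclidean_space) chart set \<Rightarrow> nat \<Rightarrow> 'm set \<Rightarrow> bool"
  where "is_submanifold A k S \<longleftrightarrow>
     (\<forall>x\<in>S. \<exists>(U, \<phi>)\<in>maximal_atlas A. x \<in> U \<and>
        (\<exists>L. subspace L \<and> dim L = k \<and> \<phi> ` (U \<inter> S) = \<phi> ` U \<inter> L))"

definition differential_zero_at ::
    "('m::topological_space, 'e::euclidean_space) chart set \<Rightarrow> ('m \<Rightarrow> real) \<Rightarrow> 'm \<Rightarrow> bool"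
  where "differential_zero_at A f x \<longleftrightarrow>
     (\<forall>(U, \<phi>)\<in>A. x \<in> U \<longrightarrow> ((f \<circ> inv_into U \<phi>) has_derivative (\<lambda>_. 0)) (at (\<phi> x)))"


section \<open>Poisson brackets\<close>

text \<open>
  A bracket is a HOL function on all of \<open>'m \<Rightarrow> real\<close>; only its values on pairs of smooth
  functions matter.
\<close>

type_synonym 'm bracket = "('m \<Rightarrow> real) \<Rightarrow> ('m \<Rightarrow> real) \<Rightarrow> ('m \<Rightarrow> real)"

definition poisson_bracket ::
    "('m::topological_space, 'e::euclidean_space) chart set \<Rightarrow> 'm bracket \<Rightarrow> bool"
  where "poisson_bracket A br \<longleftrightarrow>
     (\<forall>f\<in>smooth_functions A. \<forall>g\<in>smooth_functions A.
        br f g \<in> smooth_functions A \<and>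
        (\<forall>x. br f g x = - br g f x)) \<and>
     (\<forall>f\<in>smooth_functions A. \<forall>g\<in>smooth_functions A. \<forall>h\<in>smooth_functions A.
        (\<forall>a b x. br (\<lambda>y. a * f y + b * g y) h x = a * br f h x + b * br g h x) \<and>
        (\<forall>x. br f (\<lambda>y. g y * h y) x = br f g x * h x + g x * br f h x) \<and>
        (\<forall>x. br f (br g h) x + br g (br h f) x + br h (br f g) x = 0))"

text \<open>
  The value of \<open>br f g\<close> at \<open>x\<close> is a bilinear form in the differentials of \<open>f\<close> and \<open>g\<close> at \<open>x\<close>;
  the bracket is non-degenerate if this form on the cotangent space is non-degenerate at every
  \<open>x\<close>.
\<close>

definition nondegenerate_bracket ::
    "('m::topological_space, 'e::euclidean_space) chart set \<Rightarrow> 'm bracket \<Rightarrow> bool"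
  where "nondegenerate_bracket A br \<longleftrightarrow>
     (\<forall>x. \<forall>f\<in>smooth_functions A.
        (\<forall>g\<in>smooth_functions A. br f g x = 0) \<longrightarrow> differential_zero_at A f x)"


section \<open>Hamiltonian flows\<close>

definition hamiltonian_vf :: "'m bracket \<Rightarrow> ('m \<Rightarrow> real) \<Rightarrow> ('m \<Rightarrow> real) \<Rightarrow> ('m \<Rightarrow> real)"
  where "hamiltonian_vf br H = (\<lambda>f. br H f)"

text \<open>
  Vector fields act as derivations on smooth functions, so the tangent vector of a curve \<open>c\<close> at
  time \<open>t\<close> is the derivation sending \<open>f\<close> to the derivative of \<open>f \<circ> c\<close> at \<open>t\<close>.
\<close>

definition integral_curve ::
    "('m::topological_space, 'e::euclidean_space) chart set \<Rightarrow> 'm bracket \<Rightarrow> ('m \<Rightarrow> real) \<Rightarrow>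
     (real \<Rightarrow> 'm) \<Rightarrow> bool"
  where "integral_curve A br H c \<longleftrightarrow>
     continuous_on UNIV c \<and>
     (\<forall>f\<in>smooth_functions A. \<forall>t.
        ((\<lambda>s. f (c s)) has_real_derivative hamiltonian_vf br H f (c t)) (at t))"

definition complete_flow ::
    "('m::topological_space, 'e::euclidean_space) chart set \<Rightarrow> 'm bracket \<Rightarrow> ('m \<Rightarrow> real) \<Rightarrow> bool"
  where "complete_flow A br H \<longleftrightarrow> (\<forall>x. \<exists>c. integral_curve A br H c \<and> c 0 = x)"

text \<open>
  Integral curves are taken on the whole real line; \<open>flow\<close> is therefore meaningful for \<open>H\<close> with
  \<open>complete_flow A br H\<close>, uniqueness of integral curves being the usual theorem on ODEs.
\<close>

definition flow ::
    "('m::topological_space, 'e::euclidean_space) chart set \<Rightarrow> 'm bracket \<Rightarrow> ('m \<Rightarrow> real) \<Rightarrow>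
     real \<Rightarrow> 'm \<Rightarrow> 'm"
  where "flow A br H t x = (THE y. \<exists>c. integral_curve A br H c \<and> c 0 = x \<and> c t = y)"


section \<open>Constraints, gauge orbits, complete observables\<close>

text \<open>The constraints are indexed by a finite type \<open>'n\<close>, so that \<open>n\<close> is \<open>CARD('n)\<close>.\<close>

definition constraint_surface :: "('n::finite \<Rightarrow> 'm \<Rightarrow> real) \<Rightarrow> 'm set"
  where "constraint_surface C = {x. \<forall>i. C i x = 0}"

definition independent_constraints ::
    "('m::topological_space, 'e::euclidean_space) chart set \<Rightarrow> ('n::finite \<Rightarrow> 'm \<Rightarrow> real) \<Rightarrow> bool"
  where "independent_constraints A C \<longleftrightarrow>
     is_submanifold A (DIM('e) - CARD('n)) (constraint_surface C)"

definition first_class ::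
    "('m::topological_space, 'e::euclidean_space) chart set \<Rightarrow> 'm bracket \<Rightarrow>
     ('n::finite \<Rightarrow> 'm \<Rightarrow> real) \<Rightarrow> bool"
  where "first_class A br C \<longleftrightarrow>
     (\<exists>s :: 'n \<Rightarrow> 'n \<Rightarrow> 'n \<Rightarrow> 'm \<Rightarrow> real.
        (\<forall>i j k. s i j k \<in> smooth_functions A) \<and>
        (\<forall>i j x. br (C i) (C j) x = (\<Sum>k\<in>UNIV. s i j k x * C k x)))"

definition constraint_sum :: "('n::finite \<Rightarrow> 'm \<Rightarrow> real) \<Rightarrow> real ^ 'n \<Rightarrow> 'm \<Rightarrow> real"
  where "constraint_sum C \<beta> = (\<lambda>x. \<Sum>j\<in>UNIV. \<beta> $ j * C j x)"

definition gauge_map ::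
    "('m::topological_space, 'e::euclidean_space) chart set \<Rightarrow> 'm bracket \<Rightarrow>
     ('n::finite \<Rightarrow> 'm \<Rightarrow> real) \<Rightarrow> real ^ 'n \<Rightarrow> 'm \<Rightarrow> 'm"
  where "gauge_map A br C \<beta> = flow A br (constraint_sum C \<beta>) 1"

inductive_set gauge_orbit ::
    "('m::topological_space, 'e::euclidean_space) chart set \<Rightarrow> 'm bracket \<Rightarrow>
     ('n::finite \<Rightarrow> 'm \<Rightarrow> real) \<Rightarrow> 'm \<Rightarrow> 'm set"
  for A br C x
  where
    base: "x \<in> gauge_orbit A br C x"
  | step: "y \<in> gauge_orbit A br C x \<Longrightarrow>
       flow A br (constraint_sum C \<beta>) t y \<in> gauge_orbit A br C x"

definition clock_solutions ::
    "('m::topological_space, 'e::euclidean_space) chart set \<Rightarrow> 'm bracket \<Rightarrow>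
     ('n::finite \<Rightarrow> 'm \<Rightarrow> real) \<Rightarrow> ('n \<Rightarrow> 'm \<Rightarrow> real) \<Rightarrow> real ^ 'n \<Rightarrow> 'm \<Rightarrow> (real ^ 'n) set"
  where "clock_solutions A br C T \<tau> x = {\<beta>. \<forall>i. T i (gauge_map A br C \<beta> x) = \<tau> $ i}"

definition complete_observable_defined ::
    "('m::topological_space, 'e::euclidean_space) chart set \<Rightarrow> 'm bracket \<Rightarrow>
     ('n::finite \<Rightarrow> 'm \<Rightarrow> real) \<Rightarrow> ('m \<Rightarrow> real) \<Rightarrow> ('n \<Rightarrow> 'm \<Rightarrow> real) \<Rightarrow> real ^ 'n \<Rightarrow> 'm \<Rightarrow> bool"
  where "complete_observable_defined A br C f T \<tau> x \<longleftrightarrow>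
     clock_solutions A br C T \<tau> x \<noteq> {} \<and>
     (\<forall>\<beta>\<in>clock_solutions A br C T \<tau> x. \<forall>\<gamma>\<in>clock_solutions A br C T \<tau> x.
        f (gauge_map A br C \<beta> x) = f (gauge_map A br C \<gamma> x))"

definition complete_observable ::
    "('m::topological_space, 'e::euclidean_space) chart set \<Rightarrow> 'm bracket \<Rightarrow>
     ('n::finite \<Rightarrow> 'm \<Rightarrow> real) \<Rightarrow> ('m \<Rightarrow> real) \<Rightarrow> ('n \<Rightarrow> 'm \<Rightarrow> real) \<Rightarrow> real ^ 'n \<Rightarrow> 'm \<Rightarrow> real"
  where "complete_observable A br C f T \<tau> x =
     (THE v. \<exists>\<beta>\<in>clock_solutions A br C T \<tau> x. v = f (gauge_map A br C \<beta> x))"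

end

theory Submission
  imports Defs "HOL-Real_Asymp.Real_Asymp"
begin

text \<open>
  A point \<open>y\<close> of the orbit through \<open>x\<close> generates the same gauge orbit as \<open>x\<close>, since the flows can be
  undone, and \<open>y\<close> again lies on the constraint surface; so both complete observables are the common
  value of \<open>f\<close> on the same intersection of orbit and level set. Along a flow of the constraints
  the functions \<open>C\<^sub>i\<close> solve a homogeneous linear ODE by the first class property, hence stay
  \<open>0\<close> by Gronwall. Inverting a flow requires uniqueness of integral curves: tangent vectors are only
  tested on globally smooth functions, so local coordinates are multiplied by bump functions before
  Gronwall applies, and local uniqueness is globalised by connectedness of the time axis.
\<close>

section \<open>Calculus of \<open>C\<^sup>k\<close> functions\<close>

text \<open>On an open set the derivative at a point depends only on nearby values, all taken inside
  the set. This matters because maps built from \<open>inv_into U \<phi>\<close> are arbitrary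
  outside the chart image.\<close>

lemma Ck_on_cong:
  assumes "open S" "\<And>x. x \<in> S \<Longrightarrow> f x = g x" "Ck_on k S f"
  shows "Ck_on k S g"
  using assms(2,3)
proof (induction k arbitrary: f g)
  case 0
  then show ?case using continuous_on_cong[of S S f g] by simp
next
  case (Suc k)
  have D: "frechet_derivative f (at x) = frechet_derivative g (at x)" if "x \<in> S" for x
    using Suc.prems \<open>open S\<close> that by (intro frechet_derivative_transform_within_open) auto
  have "g differentiable (at x)" if x: "x \<in> S" for x
  proof -
    obtain D where "(f has_derivative D) (at x)"
      using Suc.prems x by (auto simp: differentiable_def)
    then have "(g has_derivative D) (at x)"
      by (rule has_derivative_transform_within_open[OF _ \<open>open S\<close> x]) (rule Suc.prems)
    then show ?thesis by (auto simp: differentiable_def)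
  qed
  moreover have "Ck_on k S (\<lambda>x. frechet_derivative g (at x) v)" for v
    by (rule Suc.IH[of "\<lambda>x. frechet_derivative f (at x) v"]) (use Suc.prems D in auto)
  ultimately show ?case by simp
qed

text \<open>Uniqueness of the derivative lets the later closure proofs name an explicit
  \<open>D\<close> instead of computing with \<open>frechet_derivative\<close>.\<close>

lemma Ck_on_SucI:
  assumes "open S" "\<And>x. x \<in> S \<Longrightarrow> (f has_derivative D x) (at x)" "\<And>v. Ck_on k S (\<lambda>x. D x v)"
  shows "Ck_on (Suc k) S f"
proof -
  have "D x = frechet_derivative f (at x)" if "x \<in> S" for x
    using assms(2)[OF that] by (rule frechet_derivative_at)
  then have "Ck_on k S (\<lambda>x. frechet_derivative f (at x) v)" for v
    by (intro Ck_on_cong[OF assms(1) _ assms(3)[of v]]) simp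
  then show ?thesis
    using assms(2) by (auto simp: differentiable_def)
qed

lemma Ck_on_Suc_has_derivative:
  assumes "Ck_on (Suc k) S f" "x \<in> S"
  shows "(f has_derivative frechet_derivative f (at x)) (at x)"
  using assms frechet_derivative_works by auto

lemma Ck_on_Suc_derivative:
  "Ck_on (Suc k) S f \<Longrightarrow> Ck_on k S (\<lambda>x. frechet_derivative f (at x) v)"
  by simp

text \<open>The product and chain rules mix a function with its derivatives; this brings both to the
  same order.\<close>

lemma Ck_on_SucD: "Ck_on (Suc k) S f \<Longrightarrow> Ck_on k S f"
proof (induction k arbitrary: f)
  case 0
  then show ?case
    by (auto intro!: continuous_at_imp_continuous_on differentiable_imp_continuous_within)
next
  case (Suc k)
  have "Ck_on k S (\<lambda>x. frechet_derivative f (at x) v)" for v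
    using Suc.prems by (intro Suc.IH) simp
  then show ?case using Suc.prems by simp
qed

text \<open>Differentiability is required point by point, so only continuity, at the base of the
  induction, uses that both sets are open. It serves to glue local descriptions of one
  function.\<close>

lemma Ck_on_Un:
  "open S \<Longrightarrow> open T \<Longrightarrow> Ck_on k S f \<Longrightarrow> Ck_on k T f \<Longrightarrow> Ck_on k (S \<union> T) f"
  by (induction k arbitrary: f) (auto intro: continuous_on_open_Un)

lemma Ck_on_const: "open S \<Longrightarrow> Ck_on k S (\<lambda>_. c)"
proof (induction k arbitrary: c)
  case (Suc k)
  show ?case by (rule Ck_on_SucI[where D = "\<lambda>_ _. 0"]) (use Suc in auto)
qed simp

lemma Ck_on_add:
  "open S \<Longrightarrow> Ck_on k S f \<Longrightarrow> Ck_on k S g \<Longrightarrow> Ck_on k S (\<lambda>x. f x + g x)"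
proof (induction k arbitrary: f g)
  case (Suc k)
  show ?case
  proof (rule Ck_on_SucI)
    fix x assume "x \<in> S"
    then show "((\<lambda>x. f x + g x) has_derivative
        (\<lambda>v. frechet_derivative f (at x) v + frechet_derivative g (at x) v)) (at x)"
      using Suc.prems by (intro has_derivative_add Ck_on_Suc_has_derivative)
  qed (use Suc in auto)
qed (auto intro: continuous_intros)

lemma Ck_on_scaleR:
  fixes f :: "'a::real_normed_vector \<Rightarrow> real"
  shows "open S \<Longrightarrow> Ck_on k S f \<Longrightarrow> Ck_on k S g \<Longrightarrow> Ck_on k S (\<lambda>x. f x *\<^sub>R g x)"
proof (induction k arbitrary: f g)
  case (Suc k)
  show ?case
  proof (rule Ck_on_SucI)
    fix x assume "x \<in> S"
    then show "((\<lambda>x. f x *\<^sub>R g x) has_derivative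
        (\<lambda>v. f x *\<^sub>R frechet_derivative g (at x) v + frechet_derivative f (at x) v *\<^sub>R g x)) (at x)"
      using Suc.prems by (intro has_derivative_scaleR Ck_on_Suc_has_derivative)
  next
    fix v
    show "Ck_on k S (\<lambda>x. f x *\<^sub>R frechet_derivative g (at x) v + frechet_derivative f (at x) v *\<^sub>R g x)"
      using Suc.prems
      by (intro Ck_on_add Suc.IH Ck_on_SucD[of k S f] Ck_on_SucD[of k S g] Ck_on_Suc_derivative)
  qed (use Suc in auto)
qed (auto intro: continuous_intros)

lemma Ck_on_mult:
  fixes f g :: "'a::real_normed_vector \<Rightarrow> real"
  shows "open S \<Longrightarrow> Ck_on k S f \<Longrightarrow> Ck_on k S g \<Longrightarrow> Ck_on k S (\<lambda>x. f x * g x)"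
  using Ck_on_scaleR[of S k f g] by simp

lemma Ck_on_sum:
  "finite I \<Longrightarrow> open S \<Longrightarrow> (\<And>i. i \<in> I \<Longrightarrow> Ck_on k S (f i)) \<Longrightarrow> Ck_on k S (\<lambda>x. \<Sum>i\<in>I. f i x)"
  by (induction I rule: finite_induct) (auto intro: Ck_on_const Ck_on_add)

lemma Ck_on_bounded_linear:
  assumes "bounded_linear h" "open S"
  shows "Ck_on k S f \<Longrightarrow> Ck_on k S (\<lambda>x. h (f x))"
proof (induction k arbitrary: f)
  case 0
  then show ?case using assms by (auto intro: bounded_linear.continuous_on)
next
  case (Suc k)
  show ?case
  proof (rule Ck_on_SucI[OF \<open>open S\<close>])
    fix x assume "x \<in> S"
    then show "((\<lambda>x. h (f x)) has_derivative (\<lambda>v. h (frechet_derivative f (at x) v))) (at x)"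
      by (rule bounded_linear.has_derivative[OF assms(1) Ck_on_Suc_has_derivative[OF Suc.prems]])
  qed (use Suc in auto)
qed

lemma Ck_on_ident: "open S \<Longrightarrow> Ck_on k S (\<lambda>x. x)"
proof (cases k)
  case (Suc j)
  assume "open S"
  then show ?thesis
    unfolding Suc by (rule Ck_on_SucI[where D = "\<lambda>_ v. v"]) (auto intro: Ck_on_const \<open>open S\<close>)
qed simp

lemma Ck_on_compose:
  fixes f :: "'a::real_normed_vector \<Rightarrow> 'b::euclidean_space"
    and g :: "'b \<Rightarrow> 'c::real_normed_vector"
  assumes "open S" "f ` S \<subseteq> T"
  shows "Ck_on k S f \<Longrightarrow> Ck_on k T g \<Longrightarrow> Ck_on k S (\<lambda>x. g (f x))"
proof (induction k arbitrary: g)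
  case 0
  then show ?case using assms by (auto intro: continuous_on_compose2)
next
  case (Suc k)
  \<comment> \<open>\<open>Ck_on\<close> controls derivatives in a fixed direction, but in the chain
    rule the direction \<open>frechet_derivative f (at x) v\<close> moves with \<open>x\<close>.
    Expanding it over \<open>Basis\<close> leaves fixed directions with scalar coefficients.\<close>
  let ?D = "\<lambda>x v. \<Sum>b\<in>Basis. (frechet_derivative f (at x) v \<bullet> b) *\<^sub>R frechet_derivative g (at (f x)) b"
  show ?case
  proof (rule Ck_on_SucI[OF \<open>open S\<close>])
    fix x assume "x \<in> S"
    then have "f x \<in> T" using assms by auto
    have f: "(f has_derivative frechet_derivative f (at x)) (at x)"
      and g: "(g has_derivative frechet_derivative g (at (f x))) (at (f x))"
      using Ck_on_Suc_has_derivative[OF Suc.prems(1) \<open>x \<in> S\<close>]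
        Ck_on_Suc_has_derivative[OF Suc.prems(2) \<open>f x \<in> T\<close>] by simp_all
    interpret bounded_linear "frechet_derivative g (at (f x))"
      using g by (rule has_derivative_bounded_linear)
    have lin: "frechet_derivative g (at (f x)) w = (\<Sum>b\<in>Basis. (w \<bullet> b) *\<^sub>R frechet_derivative g (at (f x)) b)" for w
      by (subst euclidean_representation[of w, symmetric]) (simp only: sum scale)
    have "?D x = (\<lambda>v. frechet_derivative g (at (f x)) (frechet_derivative f (at x) v))"
      by (rule ext) (rule lin[symmetric])
    then show "((\<lambda>x. g (f x)) has_derivative ?D x) (at x)"
      using has_derivative_compose[OF f g] by simp
  next
    fix v
    show "Ck_on k S (\<lambda>x. ?D x v)"
      using Suc.prems assms
      by (intro Ck_on_sum Ck_on_scaleR Ck_on_bounded_linear[OF bounded_linear_inner_left]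
          Suc.IH Ck_on_SucD[of k S f] Ck_on_Suc_derivative) auto
  qed
qed

text \<open>The partial derivatives are continuous, hence bounded on a compact ball inside
  \<open>S\<close>. The ball is convex, so the mean value inequality applies with the sum of these
  bounds as constant.\<close>

lemma Ck_on_1_lipschitz:
  fixes f :: "'a::euclidean_space \<Rightarrow> real"
  assumes "Ck_on 1 S f" "open S" "z \<in> S"
  obtains r L where "r > 0" "cball z r \<subseteq> S"
    "\<And>x y. x \<in> cball z r \<Longrightarrow> y \<in> cball z r \<Longrightarrow> \<bar>f x - f y\<bar> \<le> L * norm (x - y)"
proof -
  obtain r where r: "r > 0" "cball z r \<subseteq> S"
    using assms open_contains_cball by blast
  let ?D = "\<lambda>x. frechet_derivative f (at x)"
  have C: "Ck_on (Suc 0) S f" using assms by simp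
  have "\<exists>M. \<forall>x\<in>cball z r. \<bar>?D x b\<bar> \<le> M" for b
  proof -
    have "continuous_on (cball z r) (\<lambda>x. ?D x b)"
      using C r by (auto intro: continuous_on_subset)
    then have "bounded ((\<lambda>x. ?D x b) ` cball z r)"
      by (intro compact_imp_bounded compact_continuous_image) auto
    then show ?thesis by (auto simp: bounded_iff)
  qed
  then obtain M where M: "\<And>b x. x \<in> cball z r \<Longrightarrow> \<bar>?D x b\<bar> \<le> M b" by metis
  have "\<bar>f x - f y\<bar> \<le> (\<Sum>b\<in>Basis. M b) * norm (x - y)" if "x \<in> cball z r" "y \<in> cball z r" for x y
  proof -
    have "norm (f x - f y) \<le> (\<Sum>b\<in>Basis. M b) * norm (x - y)"
    proof (rule differentiable_bound[OF convex_cball _ _ that])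
      fix w assume w: "w \<in> cball z r"
      show d: "(f has_derivative ?D w) (at w within cball z r)"
        using w r by (intro has_derivative_at_withinI[OF Ck_on_Suc_has_derivative[OF C]]) auto
      interpret bounded_linear "?D w" using d by (rule has_derivative_bounded_linear)
      show "onorm (?D w) \<le> (\<Sum>b\<in>Basis. M b)"
      proof (rule onorm_le)
        fix v
        have "?D w v = (\<Sum>b\<in>Basis. (v \<bullet> b) * ?D w b)"
          by (subst euclidean_representation[of v, symmetric]) (simp only: sum scale real_scaleR_def)
        also have "\<bar>\<dots>\<bar> \<le> (\<Sum>b\<in>Basis. norm v * M b)"
          by (rule sum_abs[THEN order_trans], rule sum_mono)
            (auto simp: abs_mult intro!: mult_mono Basis_le_norm M w)
        finally show "norm (?D w v) \<le> (\<Sum>b\<in>Basis. M b) * norm v"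
          by (simp add: sum_distrib_left mult.commute)
      qed
    qed
    then show ?thesis by simp
  qed
  then show ?thesis using that r by blast
qed

section \<open>Bump functions\<close>

text \<open>The extra power \<open>n\<close> makes the family closed under differentiation up to
  linear combinations, so smoothness of all members is a single induction on the order.\<close>

definition flat_exp :: "nat \<Rightarrow> real \<Rightarrow> real"
  where "flat_exp n x = (if x > 0 then exp (- inverse x) * inverse x ^ n else 0)"

lemma flat_exp_DERIV:
  "(flat_exp n has_real_derivative flat_exp (n + 2) x - n * flat_exp (n + 1) x) (at x)"
proof -
  consider "x > 0" | "x < 0" | "x = 0" by linarith
  then show ?thesis
  proof cases
    case 1
    \<comment> \<open>The power rule produces the truncated exponent \<open>n - 1\<close>, hence the
      case split on \<open>n\<close>.\<close>
    have "((\<lambda>x. exp (- inverse x) * inverse x ^ n) has_real_derivative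
        flat_exp (n + 2) x - n * flat_exp (n + 1) x) (at x)"
      using 1
      by (auto intro!: derivative_eq_intros simp: flat_exp_def)
        (cases n; simp add: algebra_simps power2_eq_square)
    then show ?thesis
      by (rule has_field_derivative_transform_within_open[where S = "{0<..}"])
        (use 1 in \<open>auto simp: flat_exp_def\<close>)
  next
    case 2
    have "((\<lambda>x. 0) has_real_derivative flat_exp (n + 2) x - n * flat_exp (n + 1) x) (at x)"
      using 2 by (auto simp: flat_exp_def)
    then show ?thesis
      by (rule has_field_derivative_transform_within_open[where S = "{..<0}"])
        (use 2 in \<open>auto simp: flat_exp_def\<close>)
  next
    case 3
    \<comment> \<open>The derivative claimed at the origin is 0. From the right the exponential
      beats every power of \<open>inverse h\<close>; from the left the difference quotient is
      identically 0.\<close>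
    have "((\<lambda>h. exp (- inverse h) * inverse h ^ n / h) \<longlongrightarrow> 0) (at_right (0::real))"
      by real_asymp
    then have "((\<lambda>h. flat_exp n h / h) \<longlongrightarrow> 0) (at_right 0)"
      by (rule Lim_transform_eventually)
        (auto simp: flat_exp_def eventually_at_filter)
    moreover have "((\<lambda>h. flat_exp n h / h) \<longlongrightarrow> 0) (at_left 0)"
      by (rule Lim_transform_eventually[OF tendsto_const])
        (auto simp: flat_exp_def eventually_at_filter)
    ultimately have "((\<lambda>h. flat_exp n h / h) \<longlongrightarrow> 0) (at 0)"
      by (simp add: filterlim_split_at)
    then show ?thesis using 3 by (simp add: DERIV_def flat_exp_def)
  qed
qed

lemma Ck_on_flat_exp: "Ck_on k UNIV (flat_exp n)"
proof (induction k arbitrary: n)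
  case 0
  show ?case
    using flat_exp_DERIV by (auto intro!: continuous_at_imp_continuous_on DERIV_isCont)
next
  case (Suc k)
  show ?case
  proof (rule Ck_on_SucI)
    show "(flat_exp n has_derivative
        (\<lambda>v. (flat_exp (n + 2) x + (- real n) * flat_exp (n + 1) x) * v)) (at x)" for x
      using flat_exp_DERIV[of n x] by (simp add: has_field_derivative_def)
    show "Ck_on k UNIV (\<lambda>x. (flat_exp (n + 2) x + (- real n) * flat_exp (n + 1) x) * v)" for v
      by (intro Ck_on_mult Ck_on_add Ck_on_const Suc.IH open_UNIV)
  qed simp
qed

lemma flat_exp_0_mono: "x \<le> y \<Longrightarrow> flat_exp 0 x \<le> flat_exp 0 y"
  by (auto simp: flat_exp_def le_imp_inverse_le)

text \<open>The inner \<open>flat_exp\<close> vanishes outside the ball; the outer one cuts it off at its value \<open>a\<close> at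
  radius \<open>r / \<surd>2\<close>, which produces the plateau around the centre without a quotient of functions.\<close>

lemma bump_function:
  fixes z :: "'a::euclidean_space"
  assumes "r > 0"
  obtains h :: "'a \<Rightarrow> real" where "\<And>k. Ck_on k UNIV h"
    "\<And>y. dist z y \<le> r / 2 \<Longrightarrow> h y = 1" "\<And>y. dist z y \<ge> r \<Longrightarrow> h y = 0"
proof
  define a where "a = flat_exp 0 (r\<^sup>2 / 2)"
  \<comment> \<open>Differences are spelled as sums with a factor \<open>- 1\<close> and the
    division as a constant factor, so that closure under sums, products and composition gives
    smoothness directly. The readable form is \<open>h_alt\<close>.\<close>
  define h where
    "h y = 1 + (- 1 / flat_exp 0 a) * flat_exp 0 (a + (- 1) * flat_exp 0 (r\<^sup>2 + (- 1) * ((y - z) \<bullet> (y - z))))"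
    for y
  have a: "a > 0" using assms by (simp add: a_def flat_exp_def)
  have h_alt: "h y = 1 - flat_exp 0 (a - flat_exp 0 (r\<^sup>2 - (dist z y)\<^sup>2)) / flat_exp 0 a" for y
    by (simp add: h_def dist_norm norm_minus_commute[of z y] power2_norm_eq_inner)
  show "h y = 1" if "dist z y \<le> r / 2" for y
  proof -
    have "(dist z y)\<^sup>2 \<le> (r / 2)\<^sup>2" using that by (intro power_mono) auto
    \<comment> \<open>Even \<open>r^2 - r^2 / 4\<close> is at least \<open>r^2 / 2\<close>, so the
      inner value reaches \<open>a\<close> and the argument of the outer \<open>flat_exp\<close> is
      not positive.\<close>
    then have "r\<^sup>2 / 2 \<le> r\<^sup>2 - (dist z y)\<^sup>2"
      by (simp add: power_divide) (use zero_le_power2[of r] in linarith)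
    then have "a \<le> flat_exp 0 (r\<^sup>2 - (dist z y)\<^sup>2)"
      unfolding a_def by (rule flat_exp_0_mono)
    then show ?thesis by (simp add: h_alt flat_exp_def)
  qed
  show "h y = 0" if "dist z y \<ge> r" for y
  proof -
    \<comment> \<open>Now the inner term is 0 and the two remaining terms cancel;
      \<open>a > 0\<close> keeps the denominator nonzero.\<close>
    have "r\<^sup>2 \<le> (dist z y)\<^sup>2" using that assms by (intro power_mono) auto
    then show ?thesis using a by (simp add: h_alt flat_exp_def)
  qed
  show "Ck_on k UNIV h" for k
  proof -
    have "Ck_on k UNIV (\<lambda>y. (y - z) \<bullet> (y - z))"
    proof -
      have "Ck_on k UNIV (\<lambda>y. \<Sum>b\<in>Basis. ((y + (- z)) \<bullet> b) * ((y + (- z)) \<bullet> b))"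
        by (intro Ck_on_sum Ck_on_mult Ck_on_bounded_linear[OF bounded_linear_inner_left]
            Ck_on_add Ck_on_ident Ck_on_const) auto
      then show ?thesis by (subst euclidean_inner) simp
    qed
    then show ?thesis
      unfolding h_def
      by (intro Ck_on_add Ck_on_mult Ck_on_const Ck_on_compose[OF _ _ _ Ck_on_flat_exp]) auto
  qed
qed

section \<open>Integral curves\<close>

lemma smooth_functions_Ck_on:
  "g \<in> smooth_functions A \<Longrightarrow> (U, \<phi>) \<in> A \<Longrightarrow> Ck_on k (\<phi> ` U) (g \<circ> inv_into U \<phi>)"
  by (auto simp: smooth_functions_def smooth_on_def)

lemma smooth_atlas_chart: "smooth_atlas A \<Longrightarrow> (U, \<phi>) \<in> A \<Longrightarrow> is_chart (U, \<phi>)"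
  by (auto simp: smooth_atlas_def)

lemma smooth_functions_linear_sum:
  assumes "smooth_atlas A" "finite I" "\<And>i. i \<in> I \<Longrightarrow> g i \<in> smooth_functions A"
  shows "(\<lambda>x. \<Sum>i\<in>I. a i * g i x) \<in> smooth_functions A"
proof -
  have "Ck_on k (\<phi> ` U) ((\<lambda>x. \<Sum>i\<in>I. a i * g i x) \<circ> inv_into U \<phi>)" if U: "(U, \<phi>) \<in> A" for U \<phi> k
  proof -
    have o: "open (\<phi> ` U)" using smooth_atlas_chart[OF assms(1) U] by (simp add: is_chart_def)
    have "Ck_on k (\<phi> ` U) (\<lambda>y. \<Sum>i\<in>I. a i * (g i \<circ> inv_into U \<phi>) y)"
      by (intro Ck_on_sum Ck_on_mult Ck_on_const o smooth_functions_Ck_on[OF _ U] assms(2,3))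
    then show ?thesis by (simp add: o_def)
  qed
  then show ?thesis by (auto simp: smooth_functions_def smooth_on_def)
qed

lemma chart_open_image:
  assumes "is_chart (U, \<phi>)" "open W" "W \<subseteq> U"
  shows "open (\<phi> ` W)"
proof -
  have "homeomorphism U (\<phi> ` U) \<phi> (inv_into U \<phi>)" "open (\<phi> ` U)"
    using assms by (auto simp: is_chart_def)
  moreover have "openin (top_of_set U) W"
    using assms by (simp add: openin_open_eq is_chart_def)
  ultimately show ?thesis
    using homeomorphism_imp_open_map openin_open_trans by blast
qed

text \<open>The preimage \<open>K'\<close> of \<open>K\<close> is compact, hence closed as the
  manifold is Hausdorff. In any chart on \<open>V\<close>, the open pieces \<open>V - K'\<close> and
  \<open>U \<inter> V\<close> cover \<open>V\<close>: on the first the function is 0, on the second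
  it is \<open>h\<close> composed with a smooth transition map.\<close>

lemma smooth_extension_by_zero:
  fixes A :: "('m::{t2_space, second_countable_topology}, 'e::euclidean_space) chart set"
  assumes A: "smooth_atlas A" and U: "(U, \<phi>) \<in> A"
    and h: "\<And>k. Ck_on k UNIV h" and K: "compact K" "K \<subseteq> \<phi> ` U" "\<And>y. y \<notin> K \<Longrightarrow> h y = 0"
  shows "(\<lambda>q. if q \<in> U then h (\<phi> q) else 0) \<in> smooth_functions A"
    (is "?g \<in> _")
proof -
  have cU: "is_chart (U, \<phi>)" using smooth_atlas_chart[OF A U] .
  have hU: "homeomorphism U (\<phi> ` U) \<phi> (inv_into U \<phi>)" and oU: "open U"
    using cU by (auto simp: is_chart_def)
  define K' where "K' = inv_into U \<phi> ` K"
  have "compact K'"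
    unfolding K'_def using K hU
    by (intro compact_continuous_image) (auto simp: homeomorphism_def intro: continuous_on_subset)
  then have "closed K'" by (rule compact_imp_closed)
  have K'U: "K' \<subseteq> U" unfolding K'_def using K(2) homeomorphism_image2[OF hU] by blast
  have g0: "?g q = 0" if "q \<notin> K'" for q
  proof (cases "q \<in> U")
    case True
    then have "inv_into U \<phi> (\<phi> q) = q" using hU by (auto simp: homeomorphism_def)
    then have "\<phi> q \<notin> K" using that unfolding K'_def by (metis image_eqI)
    then show ?thesis using K by simp
  qed simp
  have "Ck_on k (\<psi> ` V) (?g \<circ> inv_into V \<psi>)" if V: "(V, \<psi>) \<in> A" for V \<psi> k
  proof -
    have cV: "is_chart (V, \<psi>)" using smooth_atlas_chart[OF A V] .
    have oV: "open V" using cV by (auto simp: is_chart_def)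
    have inv: "inv_into V \<psi> (\<psi> q) = q" if "q \<in> V" for q
      using cV that by (auto simp: is_chart_def homeomorphism_def)
    have o1: "open (\<psi> ` (V - K'))"
      using oV \<open>closed K'\<close> by (intro chart_open_image[OF cV]) auto
    have o2: "open (\<psi> ` (U \<inter> V))"
      using oU oV by (intro chart_open_image[OF cV]) auto
    have "Ck_on k (\<psi> ` (V - K')) (?g \<circ> inv_into V \<psi>)"
    proof (rule Ck_on_cong[OF o1 _ Ck_on_const[OF o1, of k 0]])
      fix y assume "y \<in> \<psi> ` (V - K')"
      then obtain q where "q \<in> V" "q \<notin> K'" "y = \<psi> q" by blast
      then show "0 = (?g \<circ> inv_into V \<psi>) y" using g0[of q] by (auto simp: inv split: if_splits)
    qed
    moreover have "Ck_on k (\<psi> ` (U \<inter> V)) (?g \<circ> inv_into V \<psi>)"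
    proof (rule Ck_on_cong[OF o2])
      have "smooth_compatible (U, \<phi>) (V, \<psi>)"
        using A U V by (auto simp: smooth_atlas_def)
      then have "Ck_on k (\<psi> ` (U \<inter> V)) (\<phi> \<circ> inv_into V \<psi>)"
        by (simp add: smooth_compatible_def smooth_on_def)
      then show "Ck_on k (\<psi> ` (U \<inter> V)) (\<lambda>y. h ((\<phi> \<circ> inv_into V \<psi>) y))"
        by (rule Ck_on_compose[OF o2 subset_UNIV _ h])
    qed (auto simp: inv)
    ultimately have "Ck_on k (\<psi> ` (V - K') \<union> \<psi> ` (U \<inter> V)) (?g \<circ> inv_into V \<psi>)"
      by (intro Ck_on_Un o1 o2)
    moreover have "\<psi> ` (V - K') \<union> \<psi> ` (U \<inter> V) = \<psi> ` V" using K'U by blast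
    ultimately show ?thesis by simp
  qed
  then show ?thesis by (auto simp: smooth_functions_def smooth_on_def)
qed

lemma smooth_coordinate:
  fixes A :: "('m::{t2_space, second_countable_topology}, 'e::euclidean_space) chart set"
  assumes A: "smooth_atlas A" and U: "(U, \<phi>) \<in> A" and p: "p \<in> U"
  obtains r g where "r > 0" "cball (\<phi> p) r \<subseteq> \<phi> ` U" "\<And>b. g b \<in> smooth_functions A"
    "\<And>b q. q \<in> U \<Longrightarrow> dist (\<phi> p) (\<phi> q) \<le> r \<Longrightarrow> g b q = \<phi> q \<bullet> b"
proof -
  have "open (\<phi> ` U)" using smooth_atlas_chart[OF A U] by (simp add: is_chart_def)
  then obtain r where r: "r > 0" "cball (\<phi> p) r \<subseteq> \<phi> ` U"
    using p open_contains_cball by blast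
  obtain h :: "'e \<Rightarrow> real" where h: "\<And>k. Ck_on k UNIV h"
    "\<And>y. dist (\<phi> p) y \<le> r / 2 \<Longrightarrow> h y = 1" "\<And>y. dist (\<phi> p) y \<ge> r \<Longrightarrow> h y = 0"
    using bump_function[OF r(1)] by metis
  define g where "g b q = (if q \<in> U then h (\<phi> q) * (\<phi> q \<bullet> b) else 0)" for b q
  show thesis
  proof
    \<comment> \<open>The bump vanishes outside radius \<open>r\<close> but equals 1 only up to half
      of it, so the radius handed out is \<open>r / 2\<close>.\<close>
    show "r / 2 > 0" "cball (\<phi> p) (r / 2) \<subseteq> \<phi> ` U" using r by auto
    show "g b \<in> smooth_functions A" for b
      unfolding g_def
    proof (rule smooth_extension_by_zero[OF A U, where K = "cball (\<phi> p) r"])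
      show "Ck_on k UNIV (\<lambda>y. h y * (y \<bullet> b))" for k
        by (intro Ck_on_mult h Ck_on_bounded_linear[OF bounded_linear_inner_left] Ck_on_ident) auto
    qed (use r h in auto)
    show "g b q = \<phi> q \<bullet> b" if "q \<in> U" "dist (\<phi> p) (\<phi> q) \<le> r / 2" for b q
      using that h by (simp add: g_def)
  qed
qed

text \<open>With \<open>E = \<Sum> u\<^sub>i\<^sup>2\<close> the bound gives \<open>\<bar>E'\<bar> \<le> K E\<close>, so \<open>E e\<^sup>-\<^sup>K\<^sup>t\<close> decreases and
  \<open>E e\<^sup>K\<^sup>t\<close> increases.\<close>

lemma gronwall_zero:
  fixes u w :: "'i \<Rightarrow> real \<Rightarrow> real"
  assumes I: "finite I"
    and der: "\<And>i t. i \<in> I \<Longrightarrow> t \<in> {a..b} \<Longrightarrow> (u i has_real_derivative w i t) (at t)"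
    and bd: "\<And>i t. i \<in> I \<Longrightarrow> t \<in> {a..b} \<Longrightarrow> \<bar>w i t\<bar> \<le> L * (\<Sum>j\<in>I. \<bar>u j t\<bar>)"
    and zero: "\<And>i. i \<in> I \<Longrightarrow> u i c = 0"
    and t: "c \<in> {a..b}" "t \<in> {a..b}" and i: "i \<in> I"
  shows "u i t = 0"
proof -
  define E where "E t = (\<Sum>i\<in>I. (u i t)\<^sup>2)" for t
  define E' where "E' t = (\<Sum>i\<in>I. 2 * u i t * w i t)" for t
  \<comment> \<open>The factor \<open>2 * \<bar>L\<bar>\<close> comes from differentiating squares,
    \<open>card I\<close> from Cauchy-Schwarz, which bounds the squared sum of the
    \<open>\<bar>u j t\<bar>\<close> by \<open>card I * E t\<close>. The absolute value is taken
    because \<open>L\<close> has no assumed sign.\<close>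
  define K where "K = 2 * \<bar>L\<bar> * card I"
  have dE: "(E has_real_derivative E' t) (at t)" if "t \<in> {a..b}" for t
    unfolding E_def[abs_def] E'_def
    by (auto intro!: derivative_eq_intros der that simp: ac_simps)
  have E0: "E c = 0" using zero by (simp add: E_def)
  have Enn: "E t \<ge> 0" for t by (auto simp: E_def intro: sum_nonneg)
  have bE: "\<bar>E' t\<bar> \<le> K * E t" if "t \<in> {a..b}" for t
  proof -
    let ?s = "\<Sum>j\<in>I. \<bar>u j t\<bar>"
    have s: "?s \<ge> 0" by (auto intro: sum_nonneg)
    have "\<bar>E' t\<bar> \<le> (\<Sum>i\<in>I. \<bar>2 * u i t * w i t\<bar>)" unfolding E'_def by (rule sum_abs)
    also have "\<dots> \<le> (\<Sum>i\<in>I. 2 * \<bar>u i t\<bar> * (\<bar>L\<bar> * ?s))"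
    proof (rule sum_mono)
      fix i assume "i \<in> I"
      then have "\<bar>w i t\<bar> \<le> \<bar>L\<bar> * ?s"
        using bd[of i t] that s by (meson abs_ge_self mult_right_mono order_trans)
      then show "\<bar>2 * u i t * w i t\<bar> \<le> 2 * \<bar>u i t\<bar> * (\<bar>L\<bar> * ?s)"
        by (simp add: abs_mult mult_left_mono)
    qed
    also have "\<dots> = 2 * \<bar>L\<bar> * ?s\<^sup>2"
      by (simp add: sum_distrib_right[symmetric] sum_distrib_left[symmetric] power2_eq_square)
    also have "?s\<^sup>2 \<le> card I * E t"
      using sum_squared_le_sum_of_squares[of "\<lambda>j. \<bar>u j t\<bar>" I] I
      by (simp add: E_def mult.commute)
    finally show ?thesis by (simp add: K_def mult_left_mono mult.assoc)
  qed
  have "E t \<le> 0"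
  proof (cases "c \<le> t")
    case True
    have "E t * exp (- K * t) \<le> E c * exp (- K * c)"
    proof (rule DERIV_nonpos_imp_nonincreasing[OF True])
      fix s assume "c \<le> s" "s \<le> t"
      then have s: "s \<in> {a..b}" using t by auto
      have "((\<lambda>s. E s * exp (- K * s)) has_real_derivative (E' s - K * E s) * exp (- K * s)) (at s)"
        by (auto intro!: derivative_eq_intros dE s simp: algebra_simps)
      moreover have "(E' s - K * E s) * exp (- K * s) \<le> 0"
        using bE[OF s] by (intro mult_nonpos_nonneg) auto
      ultimately show "\<exists>y. ((\<lambda>s. E s * exp (- K * s)) has_real_derivative y) (at s) \<and> y \<le> 0" by blast
    qed
    then show ?thesis by (simp add: E0 mult_le_0_iff)
  next
    case False
    then have "t \<le> c" by simp
    then have "E t * exp (K * t) \<le> E c * exp (K * c)"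
    proof (rule DERIV_nonneg_imp_nondecreasing)
      fix s assume "t \<le> s" "s \<le> c"
      then have s: "s \<in> {a..b}" using t by auto
      have "((\<lambda>s. E s * exp (K * s)) has_real_derivative (E' s + K * E s) * exp (K * s)) (at s)"
        by (auto intro!: derivative_eq_intros dE s simp: algebra_simps)
      moreover have "(E' s + K * E s) * exp (K * s) \<ge> 0"
        using bE[OF s] by (intro mult_nonneg_nonneg) auto
      ultimately show "\<exists>y. ((\<lambda>s. E s * exp (K * s)) has_real_derivative y) (at s) \<and> y \<ge> 0" by blast
    qed
    then show ?thesis by (simp add: E0 mult_le_0_iff)
  qed
  then have "E t = 0" using Enn[of t] by simp
  then show ?thesis using I i by (simp add: E_def sum_nonneg_eq_0_iff)
qed

section \<open>Uniqueness of integral curves\<close>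

lemma integral_curve_continuous: "integral_curve A br H c \<Longrightarrow> continuous_on UNIV c"
  by (simp add: integral_curve_def)

lemma integral_curve_DERIV:
  "integral_curve A br H c \<Longrightarrow> g \<in> smooth_functions A \<Longrightarrow>
    ((\<lambda>s. g (c s)) has_real_derivative br H g (c t)) (at t)"
  by (simp add: integral_curve_def hamiltonian_vf_def)

lemma poisson_bracket_smooth:
  "poisson_bracket A br \<Longrightarrow> g \<in> smooth_functions A \<Longrightarrow> h \<in> smooth_functions A \<Longrightarrow>
    br g h \<in> smooth_functions A"
  unfolding poisson_bracket_def by blast

lemma integral_curve_locally_unique:
  fixes A :: "('m::{t2_space, second_countable_topology}, 'e::euclidean_space) chart set"
  assumes A: "smooth_atlas A" and br: "poisson_bracket A br" and H: "H \<in> smooth_functions A"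
    and c: "integral_curve A br H c" and d: "integral_curve A br H d" and eq: "c t0 = d t0"
  shows "\<exists>\<delta>>0. \<forall>t. \<bar>t - t0\<bar> < \<delta> \<longrightarrow> c t = d t"
proof -
  obtain U \<phi> where U: "(U, \<phi>) \<in> A" "c t0 \<in> U"
  proof -
    have "c t0 \<in> (\<Union>(U, \<phi>)\<in>A. U)" using A by (simp add: smooth_atlas_def)
    then show thesis using that by blast
  qed
  define z where "z = \<phi> (c t0)"
  have cU: "is_chart (U, \<phi>)" using smooth_atlas_chart[OF A U(1)] .
  have hU: "homeomorphism U (\<phi> ` U) \<phi> (inv_into U \<phi>)" and oU: "open U" and oV: "open (\<phi> ` U)"
    using cU by (auto simp: is_chart_def)
  have inv: "inv_into U \<phi> (\<phi> q) = q" if "q \<in> U" for q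
    using hU that by (auto simp: homeomorphism_def)
  obtain r g where g: "r > 0" "cball z r \<subseteq> \<phi> ` U" "\<And>b. g b \<in> smooth_functions A"
    "\<And>b q. q \<in> U \<Longrightarrow> dist z (\<phi> q) \<le> r \<Longrightarrow> g b q = \<phi> q \<bullet> b"
    by (rule smooth_coordinate[OF A U, folded z_def]) (rule that)
  \<comment> \<open>Near \<open>z\<close> the function \<open>g b\<close> is the coordinate along
    \<open>b\<close>, so \<open>X b\<close> is there the \<open>b\<close>-component of the
    Hamiltonian vector field read in the chart.\<close>
  define X where "X b = br H (g b) \<circ> inv_into U \<phi>" for b
  have "\<exists>\<rho> L. \<rho> > 0 \<and> (\<forall>x\<in>cball z \<rho>. \<forall>y\<in>cball z \<rho>. \<bar>X b x - X b y\<bar> \<le> L * norm (x - y))" for b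
  proof -
    have "Ck_on 1 (\<phi> ` U) (X b)"
      unfolding X_def
      by (intro smooth_functions_Ck_on[OF _ U(1)] poisson_bracket_smooth[OF br H] g(3))
    moreover have "z \<in> \<phi> ` U" using U unfolding z_def by blast
    ultimately obtain \<rho> L where "\<rho> > 0"
      "\<And>x y. x \<in> cball z \<rho> \<Longrightarrow> y \<in> cball z \<rho> \<Longrightarrow> \<bar>X b x - X b y\<bar> \<le> L * norm (x - y)"
      by (rule Ck_on_1_lipschitz[OF _ oV]) (rule that)
    then show ?thesis by blast
  qed
  then obtain \<rho> L where \<rho>: "\<And>b. \<rho> b > 0"
    and L: "\<And>b x y. x \<in> cball z (\<rho> b) \<Longrightarrow> y \<in> cball z (\<rho> b) \<Longrightarrow> \<bar>X b x - X b y\<bar> \<le> L b * norm (x - y)"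
    by metis
  \<comment> \<open>One radius for two purposes: within \<open>r\<close> each \<open>g b\<close>
    agrees with its coordinate, within \<open>\<rho> b\<close> the component \<open>X b\<close> is
    Lipschitz.\<close>
  define R where "R = Min (insert r (\<rho> ` Basis))"
  have R: "R > 0" "R \<le> r"
    using \<rho> g(1) by (auto simp: R_def)
  have R\<rho>: "R \<le> \<rho> b" if "b \<in> Basis" for b
    unfolding R_def using that by (intro Min_le) auto
  define W where "W = U \<inter> \<phi> -` ball z R"
  have "open W"
    unfolding W_def using hU oU
    by (intro continuous_open_preimage) (auto simp: homeomorphism_def)
  have "c t0 \<in> W" using U R by (simp add: W_def z_def)
  have "open (c -` W \<inter> d -` W)"
    using \<open>open W\<close> integral_curve_continuous[OF c] integral_curve_continuous[OF d]
    by (intro open_Int open_vimage)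
  \<comment> \<open>A closed time interval on which both curves stay in \<open>W\<close>, the form
    in which \<open>gronwall_zero\<close> is applied.\<close>
  then obtain \<delta> where \<delta>: "\<delta> > 0" "cball t0 \<delta> \<subseteq> c -` W \<inter> d -` W"
    using \<open>c t0 \<in> W\<close> eq by (metis IntI open_contains_cball vimageI)
  have W: "c t \<in> W" "d t \<in> W" if "t \<in> {t0 - \<delta>..t0 + \<delta>}" for t
    using \<delta>(2) that by (auto simp: cball_eq_atLeastAtMost)
  define u where "u b t = g b (c t) - g b (d t)" for b t
  define M where "M = (\<Sum>b\<in>Basis. \<bar>L b\<bar>)"
  have u: "u b t = (\<phi> (c t) - \<phi> (d t)) \<bullet> b" if "t \<in> {t0 - \<delta>..t0 + \<delta>}" for b t
    using W[OF that] R by (simp add: u_def W_def g inner_diff_left)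
  have u0: "u b t = 0" if b: "b \<in> Basis" and t: "t \<in> {t0 - \<delta>..t0 + \<delta>}" for b t
  proof (rule gronwall_zero[where I = Basis and u = u and a = "t0 - \<delta>" and b = "t0 + \<delta>" and c = t0])
    fix b :: 'e and t assume b: "b \<in> Basis" and t: "t \<in> {t0 - \<delta>..t0 + \<delta>}"
    show "(u b has_real_derivative br H (g b) (c t) - br H (g b) (d t)) (at t)"
      unfolding u_def
      by (intro DERIV_diff integral_curve_DERIV[OF c] integral_curve_DERIV[OF d] g)
    have "\<bar>br H (g b) (c t) - br H (g b) (d t)\<bar> = \<bar>X b (\<phi> (c t)) - X b (\<phi> (d t))\<bar>"
      using W[OF t] by (simp add: X_def W_def inv)
    also have "\<dots> \<le> L b * norm (\<phi> (c t) - \<phi> (d t))"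
      using W[OF t] R\<rho>[OF b] by (intro L) (auto simp: W_def)
    also have "\<dots> \<le> M * (\<Sum>b\<in>Basis. \<bar>u b t\<bar>)"
    proof (rule mult_mono)
      have "\<bar>L b\<bar> \<le> M" unfolding M_def using b by (intro member_le_sum) auto
      then show "L b \<le> M" by simp
      show "norm (\<phi> (c t) - \<phi> (d t)) \<le> (\<Sum>b\<in>Basis. \<bar>u b t\<bar>)"
        using norm_le_l1[of "\<phi> (c t) - \<phi> (d t)"] u[OF t] by simp
    qed (auto simp: M_def intro: sum_nonneg)
    finally show "\<bar>br H (g b) (c t) - br H (g b) (d t)\<bar> \<le> M * (\<Sum>b\<in>Basis. \<bar>u b t\<bar>)" .
  qed (use b t \<delta> in \<open>auto simp: u_def eq\<close>)
  have "c t = d t" if "\<bar>t - t0\<bar> < \<delta>" for t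
  proof -
    have t: "t \<in> {t0 - \<delta>..t0 + \<delta>}" using that by auto
    have "\<phi> (c t) = \<phi> (d t)"
    proof (rule euclidean_eqI)
      fix b :: 'e assume "b \<in> Basis"
      then show "\<phi> (c t) \<bullet> b = \<phi> (d t) \<bullet> b"
        using u0[of b t] u[OF t, of b] t by (simp add: inner_diff_left)
    qed
    moreover have "c t \<in> U" "d t \<in> U" using W[OF t] by (auto simp: W_def)
    ultimately show ?thesis by (metis inv)
  qed
  then show ?thesis using \<delta>(1) by blast
qed

lemma integral_curve_unique:
  fixes A :: "('m::{t2_space, second_countable_topology}, 'e::euclidean_space) chart set"
  assumes A: "smooth_atlas A" and br: "poisson_bracket A br" and H: "H \<in> smooth_functions A"
    and c: "integral_curve A br H c" and d: "integral_curve A br H d" and eq: "c t0 = d t0"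
  shows "c = d"
proof -
  let ?S = "{t. c t = d t}"
  have "open ?S"
    unfolding open_dist dist_real_def
    using integral_curve_locally_unique[OF A br H c d] by simp
  \<comment> \<open>Limits of coincidence times are coincidence times because the curves are
    continuous and the manifold is Hausdorff.\<close>
  moreover have "closed ?S"
    using integral_curve_continuous[OF c] integral_curve_continuous[OF d]
    by (rule closed_Collect_eq)
  ultimately have "closed ?S \<and> open ?S" by simp
  then have "?S = {} \<or> ?S = UNIV" by (rule clopen[THEN iffD1])
  moreover have "t0 \<in> ?S" using eq by simp
  ultimately have "?S = UNIV" by (metis empty_iff)
  then show ?thesis unfolding set_eq_iff fun_eq_iff by simp
qed

section \<open>Flows and their inverses\<close>

lemma integral_curve_shift:
  assumes "integral_curve A br H c"
  shows "integral_curve A br H (\<lambda>s. c (s + a))"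
proof -
  have "((\<lambda>s. f (c (s + a))) has_real_derivative hamiltonian_vf br H f (c (t + a))) (at t)"
    if "f \<in> smooth_functions A" for f t
    using assms that DERIV_shift[of "\<lambda>s. f (c s)" _ t a] unfolding integral_curve_def by blast
  moreover have "continuous_on UNIV (\<lambda>s. c (s + a))"
    using assms unfolding integral_curve_def
    by (auto intro!: continuous_on_compose2[of UNIV c] continuous_intros)
  ultimately show ?thesis by (simp add: integral_curve_def)
qed

text \<open>Uniqueness of integral curves makes the description in \<open>flow\<close> denote, so
  any integral curve at hand computes the flow.\<close>

lemma flow_eqI:
  fixes A :: "('m::{t2_space, second_countable_topology}, 'e::euclidean_space) chart set"
  assumes "smooth_atlas A" "poisson_bracket A br" "H \<in> smooth_functions A"
    and "integral_curve A br H c" "c 0 = x"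
  shows "flow A br H t x = c t"
  unfolding flow_def
proof (rule the_equality)
  fix y assume "\<exists>d. integral_curve A br H d \<and> d 0 = x \<and> d t = y"
  then obtain d where "integral_curve A br H d" "d 0 = x" "d t = y" by (elim exE conjE)
  then show "y = c t"
    using integral_curve_unique[OF assms(1-4), of d 0] assms(5) by simp
qed (intro exI[of _ c] conjI assms refl)

lemma flow_inverse:
  fixes A :: "('m::{t2_space, second_countable_topology}, 'e::euclidean_space) chart set"
  assumes "smooth_atlas A" "poisson_bracket A br" "H \<in> smooth_functions A" "complete_flow A br H"
  shows "flow A br H (- t) (flow A br H t x) = x"
proof -
  obtain c where c: "integral_curve A br H c" "c 0 = x"
    using assms by (auto simp: complete_flow_def)
  have "flow A br H t x = c t" using flow_eqI[OF assms(1-3) c] .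
  \<comment> \<open>The curve shifted by \<open>t\<close> starts at \<open>c t\<close> and is back
    at \<open>c 0\<close> at time \<open>- t\<close>.\<close>
  moreover have "flow A br H (- t) (c t) = c (- t + t)"
    by (rule flow_eqI[OF assms(1-3) integral_curve_shift[OF c(1)]]) simp
  ultimately show ?thesis using c by simp
qed

section \<open>Gauge orbits\<close>

lemma poisson_bracket_linear_sum:
  assumes A: "smooth_atlas A" and br: "poisson_bracket A br" and I: "finite I"
    and C: "\<And>j. C j \<in> smooth_functions A" and h: "h \<in> smooth_functions A"
  shows "br (\<lambda>y. \<Sum>j\<in>I. a j * C j y) h x = (\<Sum>j\<in>I. a j * br (C j) h x)"
proof -
  have lin: "br (\<lambda>y. a * f y + b * g y) h x = a * br f h x + b * br g h x"
    if "f \<in> smooth_functions A" "g \<in> smooth_functions A" for a b f g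
    by (rule br[unfolded poisson_bracket_def, THEN conjunct2, THEN bspec, OF that(1),
          THEN bspec, OF that(2), THEN bspec, OF h, THEN conjunct1, THEN spec, THEN spec, THEN spec])
  show ?thesis using I
  proof (induction I rule: finite_induct)
    case empty
    \<comment> \<open>The bracket axioms cover two-term combinations, so the zero function is
      presented as \<open>0 * h + 0 * h\<close>.\<close>
    then show ?case using lin[OF h h, of 0 0] by simp
  next
    case (insert j F)
    then show ?case
      using lin[OF C smooth_functions_linear_sum[OF A insert(1) C], of "a j" j 1 a] by simp
  qed
qed

lemma integral_curve_constraint_surface:
  fixes A :: "('m::{t2_space, second_countable_topology}, 'e::euclidean_space) chart set"
    and C :: "'n::finite \<Rightarrow> 'm \<Rightarrow> real"
  assumes A: "smooth_atlas A" and br: "poisson_bracket A br"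
    and C: "\<And>j. C j \<in> smooth_functions A" and fc: "first_class A br C"
    and c: "integral_curve A br (constraint_sum C \<beta>) c" and c0: "c 0 \<in> constraint_surface C"
  shows "c t \<in> constraint_surface C"
proof -
  obtain s where s_all: "\<forall>i j k. s i j k \<in> smooth_functions A"
    and sC: "\<forall>i j x. br (C i) (C j) x = (\<Sum>k\<in>UNIV. s i j k x * C k x)"
    using fc unfolding first_class_def by (elim exE conjE)
  have s: "s i j k \<in> smooth_functions A" for i j k using s_all by simp
  \<comment> \<open>A compact interval containing both 0 and \<open>t\<close> whatever the sign of
    \<open>t\<close>; the structure functions are bounded along the curve on it.\<close>
  define T where "T = {- \<bar>t\<bar>..\<bar>t\<bar>}"
  have "\<exists>M. \<forall>\<tau>\<in>T. \<bar>s i j k (c \<tau>)\<bar> \<le> M" for i j k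
  proof -
    have "continuous_on T (\<lambda>\<tau>. s i j k (c \<tau>))"
      using integral_curve_DERIV[OF c s]
      by (auto intro!: continuous_at_imp_continuous_on DERIV_isCont)
    then have "bounded ((\<lambda>\<tau>. s i j k (c \<tau>)) ` T)"
      unfolding T_def by (intro compact_imp_bounded compact_continuous_image) auto
    then show ?thesis by (auto simp: bounded_iff)
  qed
  then obtain M where M: "\<And>i j k \<tau>. \<tau> \<in> T \<Longrightarrow> \<bar>s i j k (c \<tau>)\<bar> \<le> M i j k" by metis
  \<comment> \<open>Summing also over \<open>i\<close> gives one constant valid for every
    constraint; the absolute values make all summands nonnegative, so each inner sum is at most the
    total.\<close>
  define L where "L = (\<Sum>i\<in>UNIV. \<Sum>j\<in>UNIV. \<Sum>k\<in>UNIV. \<bar>\<beta> $ j\<bar> * \<bar>M j i k\<bar>)"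
  \<comment> \<open>The generator stands in the first slot of the bracket, so
    \<open>br (C j) (C i)\<close> appears and the structure functions carry the indices
    \<open>j i k\<close>.\<close>
  have der: "((\<lambda>\<tau>. C i (c \<tau>)) has_real_derivative
      (\<Sum>j\<in>UNIV. \<beta> $ j * (\<Sum>k\<in>UNIV. s j i k (c \<tau>) * C k (c \<tau>)))) (at \<tau>)" for i \<tau>
    using integral_curve_DERIV[OF c C, of i \<tau>]
    by (simp add: constraint_sum_def poisson_bracket_linear_sum[OF A br finite C C] sC)
  have "C i (c t) = 0" for i
  proof (rule gronwall_zero[where I = UNIV and u = "\<lambda>i \<tau>. C i (c \<tau>)"
        and a = "- \<bar>t\<bar>" and b = "\<bar>t\<bar>" and c = 0 and L = L])
    fix i \<tau> assume \<tau>: "\<tau> \<in> {- \<bar>t\<bar>..\<bar>t\<bar>}"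
    show "((\<lambda>\<tau>. C i (c \<tau>)) has_real_derivative
      (\<Sum>j\<in>UNIV. \<beta> $ j * (\<Sum>k\<in>UNIV. s j i k (c \<tau>) * C k (c \<tau>)))) (at \<tau>)" by (rule der)
    let ?S = "\<Sum>k\<in>UNIV. \<bar>C k (c \<tau>)\<bar>"
    have "\<bar>\<Sum>j\<in>UNIV. \<beta> $ j * (\<Sum>k\<in>UNIV. s j i k (c \<tau>) * C k (c \<tau>))\<bar>
        = \<bar>\<Sum>j\<in>UNIV. \<Sum>k\<in>UNIV. \<beta> $ j * (s j i k (c \<tau>) * C k (c \<tau>))\<bar>"
      by (simp add: sum_distrib_left)
    also have "\<dots> \<le> (\<Sum>j\<in>UNIV. \<Sum>k\<in>UNIV. \<bar>\<beta> $ j\<bar> * \<bar>M j i k\<bar> * ?S)"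
    proof (rule sum_abs[THEN order_trans], rule sum_mono, rule sum_abs[THEN order_trans], rule sum_mono)
      fix j k
      have "\<bar>s j i k (c \<tau>)\<bar> \<le> \<bar>M j i k\<bar>" using M[of \<tau> j i k] \<tau> unfolding T_def by linarith
      moreover have "\<bar>C k (c \<tau>)\<bar> \<le> ?S" by (rule member_le_sum) auto
      ultimately show "\<bar>\<beta> $ j * (s j i k (c \<tau>) * C k (c \<tau>))\<bar> \<le> \<bar>\<beta> $ j\<bar> * \<bar>M j i k\<bar> * ?S"
        unfolding abs_mult mult.assoc by (intro mult_left_mono mult_mono) auto
    qed
    also have "\<dots> = (\<Sum>j\<in>UNIV. \<Sum>k\<in>UNIV. \<bar>\<beta> $ j\<bar> * \<bar>M j i k\<bar>) * ?S"
      by (simp add: sum_distrib_right)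
    also have "\<dots> \<le> L * ?S"
      unfolding L_def
      by (intro mult_right_mono sum_nonneg
          member_le_sum[where f = "\<lambda>i. \<Sum>j\<in>UNIV. \<Sum>k\<in>UNIV. \<bar>\<beta> $ j\<bar> * \<bar>M j i k\<bar>"]) (auto intro: sum_nonneg)
    finally show "\<bar>\<Sum>j\<in>UNIV. \<beta> $ j * (\<Sum>k\<in>UNIV. s j i k (c \<tau>) * C k (c \<tau>))\<bar> \<le> L * ?S" .
  qed (use c0 in \<open>auto simp: constraint_surface_def\<close>)
  then show ?thesis by (simp add: constraint_surface_def)
qed

section \<open>Orbits and complete observables\<close>

lemma gauge_orbit_trans:
  assumes "z \<in> gauge_orbit A br C y" "y \<in> gauge_orbit A br C x"
  shows "z \<in> gauge_orbit A br C x"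
  using assms by (induction rule: gauge_orbit.induct) (auto intro: gauge_orbit.step)

lemma gauge_map_in_orbit: "gauge_map A br C \<beta> x \<in> gauge_orbit A br C x"
  unfolding gauge_map_def by (intro gauge_orbit.intros)

text \<open>Independence of the chosen clock solution is exactly the uniqueness that the description
  in \<open>complete_observable\<close> needs.\<close>

lemma complete_observable_eqI:
  assumes "complete_observable_defined A br C f T \<tau> x" "\<beta> \<in> clock_solutions A br C T \<tau> x"
  shows "complete_observable A br C f T \<tau> x = f (gauge_map A br C \<beta> x)"
  using assms unfolding complete_observable_def complete_observable_defined_def
  by (intro the_equality) blast+

theorem theorem4p1:
  fixes A :: "('m::{t2_space, second_countable_topology}, 'e::euclidean_space) chart set"
    and br :: "'m bracket"
    and p :: nat
    and C T :: "'n::finite \<Rightarrow> 'm \<Rightarrow> real"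
    and f :: "'m \<Rightarrow> real"
    and \<tau> :: "real ^ 'n"
    and x :: 'm
  assumes manifold: "smooth_atlas A" "DIM('e) = 2 * p"
    and bracket: "poisson_bracket A br" "nondegenerate_bracket A br"
    and number: "CARD('n) < p"
    and constraints: "\<And>j. C j \<in> smooth_functions A"
      "independent_constraints A C" "first_class A br C"
    and flows: "\<And>\<beta>. complete_flow A br (constraint_sum C \<beta>)"
    and orbits: "\<And>y z. y \<in> constraint_surface C \<Longrightarrow> z \<in> gauge_orbit A br C y \<Longrightarrow>
      \<exists>\<beta>. z = gauge_map A br C \<beta> y"
    and x: "x \<in> constraint_surface C"
    and smooth: "\<And>i. T i \<in> smooth_functions A" "f \<in> smooth_functions A"
    and nonempty: "{z. \<forall>i. T i z = \<tau> $ i} \<inter> gauge_orbit A br C x \<noteq> {}"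
    and same_value: "\<And>y z. y \<in> {z. \<forall>i. T i z = \<tau> $ i} \<inter> gauge_orbit A br C x \<Longrightarrow>
      z \<in> {z. \<forall>i. T i z = \<tau> $ i} \<inter> gauge_orbit A br C x \<Longrightarrow> f y = f z"
  shows "complete_observable_defined A br C f T \<tau> x \<and>
    (\<forall>\<epsilon>. complete_observable_defined A br C f T \<tau> (gauge_map A br C \<epsilon> x) \<and>
      complete_observable A br C f T \<tau> (gauge_map A br C \<epsilon> x) =
        complete_observable A br C f T \<tau> x)"
proof -
  let ?Z = "{z. \<forall>i. T i z = \<tau> $ i}"
  have sum_smooth: "constraint_sum C \<beta> \<in> smooth_functions A" for \<beta>
    unfolding constraint_sum_def
    using manifold(1) constraints(1) by (intro smooth_functions_linear_sum) auto
  \<comment> \<open>Stated for every such \<open>y\<close> so that it serves both \<open>x\<close>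
    and the displaced point. The witness lies in the orbit of \<open>x\<close> in either case, which
    makes the two values comparable.\<close>
  have defined: "complete_observable_defined A br C f T \<tau> y \<and>
      (\<exists>z\<in>?Z \<inter> gauge_orbit A br C x. complete_observable A br C f T \<tau> y = f z)"
    if y: "y \<in> constraint_surface C" and orb: "gauge_orbit A br C y = gauge_orbit A br C x" for y
  proof -
    have sol: "gauge_map A br C \<beta> y \<in> ?Z \<inter> gauge_orbit A br C x"
      if "\<beta> \<in> clock_solutions A br C T \<tau> y" for \<beta>
      using that gauge_map_in_orbit[of A br C \<beta> y] orb by (auto simp: clock_solutions_def)
    obtain z where z: "z \<in> ?Z" "z \<in> gauge_orbit A br C y" using nonempty orb by blast
    \<comment> \<open>The standing assumption on orbits, applied at \<open>y\<close> on the
      constraint surface, turns a composition of flows into a single \<open>gauge_map\<close> and so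
      yields a clock solution.\<close>
    obtain \<beta> where "z = gauge_map A br C \<beta> y" using orbits[OF y z(2)] by blast
    then have \<beta>: "\<beta> \<in> clock_solutions A br C T \<tau> y" using z by (simp add: clock_solutions_def)
    have def: "complete_observable_defined A br C f T \<tau> y"
      using \<beta> same_value[OF sol sol] unfolding complete_observable_defined_def by blast
    show ?thesis using def complete_observable_eqI[OF def \<beta>] sol[OF \<beta>] by blast
  qed
  have at_x: "complete_observable_defined A br C f T \<tau> x \<and>
      (\<exists>z\<in>?Z \<inter> gauge_orbit A br C x. complete_observable A br C f T \<tau> x = f z)"
    using defined[OF x] by simp
  have at_y: "complete_observable_defined A br C f T \<tau> (gauge_map A br C \<epsilon> x) \<and>
      (\<exists>z\<in>?Z \<inter> gauge_orbit A br C x. complete_observable A br C f T \<tau> (gauge_map A br C \<epsilon> x) = f z)"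
    for \<epsilon>
  proof (rule defined)
    let ?y = "gauge_map A br C \<epsilon> x"
    obtain c where c: "integral_curve A br (constraint_sum C \<epsilon>) c" "c 0 = x"
      using flows by (auto simp: complete_flow_def)
    have "?y = c 1"
      unfolding gauge_map_def by (rule flow_eqI[OF manifold(1) bracket(1) sum_smooth c])
    then show "?y \<in> constraint_surface C"
      using integral_curve_constraint_surface[OF manifold(1) bracket(1) constraints(1,3) c(1)] c(2) x
      by simp
    \<comment> \<open>The same generator run for time \<open>- 1\<close> returns to
      \<open>x\<close>. Each point thus lies in the orbit of the other, and transitivity makes the
      orbits equal.\<close>
    have "flow A br (constraint_sum C \<epsilon>) (- 1) ?y = x"
      unfolding gauge_map_def by (rule flow_inverse[OF manifold(1) bracket(1) sum_smooth flows])
    then have "x \<in> gauge_orbit A br C ?y"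
      using gauge_orbit.step[OF gauge_orbit.base, of A br C \<epsilon> "- 1" ?y] by simp
    then show "gauge_orbit A br C ?y = gauge_orbit A br C x"
      using gauge_orbit_trans gauge_map_in_orbit[of A br C \<epsilon> x] by blast
  qed
  have "complete_observable A br C f T \<tau> (gauge_map A br C \<epsilon> x) = complete_observable A br C f T \<tau> x" for \<epsilon>
  proof -
    obtain y z where "y \<in> ?Z \<inter> gauge_orbit A br C x" "z \<in> ?Z \<inter> gauge_orbit A br C x"
      "complete_observable A br C f T \<tau> (gauge_map A br C \<epsilon> x) = f y"
      "complete_observable A br C f T \<tau> x = f z"
      using conjunct2[OF at_x] conjunct2[OF at_y[of \<epsilon>]] by (elim bexE)
    then show ?thesis using same_value[of y z] by simp
  qed
  then show ?thesis
    using conjunct1[OF at_x] conjunct1[OF at_y] by (intro conjI allI)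
qed

end
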